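(* Let $BD=(T,A,\{f_p:p\in A^P\})$ be basic data. Then, with composition $\mu\nu$ of $\mu,\nu\in\Lambda_{BD}^*$ with $s(\mu)=r(\nu)$ given by the unique path $\lambda\in\Lambda_{BD}^{d(\mu)+d(\nu)}$ satisfying $\lambda(0,d(\mu))=\mu$ and $\lambda(d(\mu),d(\mu)+d(\nu))=\nu$, the quadruple $\Lambda_{BD}:=(\Lambda_{BD}^0,\Lambda_{BD}^*,r,s)$ is a category. The function $d:\Lambda_{BD}\to\mathbb N^2$ given by $d(\lambda)=n$ for $\lambda\in\Lambda_{BD}^n$ is a functor satisfying the factorisation property; hence $(\Lambda_{BD},d)$ is a $2$-graph.
   Context: $\mathbb N=\{0,1,2,\dots\}$; $\mathbb N^2$ is a semigroup under addition with basis $e_1,e_2$ and the coordinatewise partial order $\le$. A tile $T$ is a nonempty finite subset of $\mathbb N^2$ that is hereditary ($n\in T$ and $0\le m\le n$ imply $m\in T$); $(c_1,c_2)$ denotes the coordinatewise maximum of the elements of $T$; $T$ is nondegenerate if $|T|\ge 2$. For nondegenerate $T$ put $P=T\setminus\{c_1e_1,c_2e_2\}$. Basic data is a triple $BD=(T,A,\{f_p:p\in A^P\})$ where $T$ is a nondegenerate tile, $A$ is a finite nonempty set, and for each function $p\in A^P$ (with $A^\emptyset=\{\emptyset\}$), $f_p:A\to A$ is a bijection. For $p\in A^P$, $a\in A$ define $F_{p,a}:T\to A$ by $F_{p,a}(c_2e_2)=a$, $F_{p,a}(c_1e_1)=f_p(a)$, $F_{p,a}(t)=p(t)$ for $t\in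 P$, and let $\Lambda_{BD}^0=\{F_{p,a}:p\in A^P,a\in A\}$. For $S\subset\mathbb N^2$, $n\in\mathbb N^2$ let $S+n=\{m+n:m\in S\}$, and $T(n)=\bigcup_{0\le m\le n}(T+m)$. If $f:S\to A$ with $T+n\subset S$, define $f\downarrow_{T+n}:T\to A$ by $f\downarrow_{T+n}(i)=f(i+n)$. A path of degree $n\in\mathbb N^2$ is a function $\lambda:T(n)\to A$ with $\lambda\downarrow_{T+m}\in\Lambda_{BD}^0$ for all $0\le m\le n$; its range is $r(\lambda)=\lambda\downarrow_T$ and its source is $s(\lambda)=\lambda\downarrow_{T+n}$. $\Lambda_{BD}^n$ is the set of paths of degree $n$, and $\Lambda_{BD}^*=\bigcup_{n\in\mathbb N^2}\Lambda_{BD}^n$ (the union is regarded as disjoint, so each path carries its degree). For $\lambda\in\Lambda_{BD}^\ell$ and $0\le m\le n\le\ell$, $\lambda(m,n)$ is the path of degree $n-m$ given by $\lambda(m,n)(i)=\lambda(m+i)$ for $i\in T(n-m)$. A $k$-graph is a countable category $\Lambda$ with a functor $d:\Lambda\to\mathbb N^k$ satisfying the factorisation property: for every $\lambda\in\Lambda$ and $m,n\in\mathbb N^k$ with $d(\lambda)=m+n$ there exist unique $\mu,\nu\in\Lambda$ with $d(\mu)=m$, $d(\nu)=n$ and $\lambda=\mu\nu$. Composites $\mu\nu$ are defined when $s(\mu)=r(\nu)$. *)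

theory Defs
  imports
    Complex_Main
    "HOL-Library.Countable_Set"
    "HOL-Library.FuncSet"
    "HOL-Library.Product_Order"
    "HOL-Library.Product_Plus"
begin

text \<open>The semigroup \<open>\<nat>\<^sup>2\<close> is the type \<open>nat \<times> nat\<close>, with the componentwise addition and subtraction
  of Product_Plus and the componentwise partial order of Product_Order. Since \<open>0 \<le> m\<close> holds for
  all \<open>m\<close> in this type, lower bounds \<open>0 \<le> m\<close> are not written.
  A function \<open>S \<rightarrow> A\<close> is an element of \<open>S \<rightarrow>\<^sub>E A\<close>, i.e. it takes the value \<open>undefined\<close>
  outside \<open>S\<close>, so that equality in HOL is equality of functions on \<open>S\<close>.\<close>

type_synonym N2 = "nat \<times> nat"

text \<open>Composites \<open>\<mu>\<nu>\<close> are formed when \<open>s \<mu> = r \<nu>\<close>; nothing is required of \<open>cmp \<mu> \<nu>\<close> for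
  other pairs.\<close>

definition is_identity ::
  "'m set \<Rightarrow> ('m \<Rightarrow> 'o) \<Rightarrow> ('m \<Rightarrow> 'o) \<Rightarrow> ('m \<Rightarrow> 'm \<Rightarrow> 'm) \<Rightarrow> 'o \<Rightarrow> 'm \<Rightarrow> bool" where
  "is_identity Mor r s cmp v e \<longleftrightarrow>
     e \<in> Mor \<and> r e = v \<and> s e = v \<and>
     (\<forall>\<mu>\<in>Mor. r \<mu> = v \<longrightarrow> cmp e \<mu> = \<mu>) \<and>
     (\<forall>\<mu>\<in>Mor. s \<mu> = v \<longrightarrow> cmp \<mu> e = \<mu>)"

locale small_category =
  fixes Obj :: "'o set" and Mor :: "'m set"
    and r :: "'m \<Rightarrow> 'o" and s :: "'m \<Rightarrow> 'o"
    and cmp :: "'m \<Rightarrow> 'm \<Rightarrow> 'm"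
  assumes range_in_Obj: "\<mu> \<in> Mor \<Longrightarrow> r \<mu> \<in> Obj"
    and source_in_Obj: "\<mu> \<in> Mor \<Longrightarrow> s \<mu> \<in> Obj"
    and comp_in_Mor: "\<lbrakk>\<mu> \<in> Mor; \<nu> \<in> Mor; s \<mu> = r \<nu>\<rbrakk> \<Longrightarrow> cmp \<mu> \<nu> \<in> Mor"
    and range_comp: "\<lbrakk>\<mu> \<in> Mor; \<nu> \<in> Mor; s \<mu> = r \<nu>\<rbrakk> \<Longrightarrow> r (cmp \<mu> \<nu>) = r \<mu>"
    and source_comp: "\<lbrakk>\<mu> \<in> Mor; \<nu> \<in> Mor; s \<mu> = r \<nu>\<rbrakk> \<Longrightarrow> s (cmp \<mu> \<nu>) = s \<nu>"
    and comp_assoc: "\<lbrakk>\<kappa> \<in> Mor; \<mu> \<in> Mor; \<nu> \<in> Mor; s \<kappa> = r \<mu>; s \<mu> = r \<nu>\<rbrakk>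
          \<Longrightarrow> cmp (cmp \<kappa> \<mu>) \<nu> = cmp \<kappa> (cmp \<mu> \<nu>)"
    and identity_exists: "v \<in> Obj \<Longrightarrow> \<exists>e. is_identity Mor r s cmp v e"

text \<open>A functor from a category to a monoid, the latter viewed as a category with one object.\<close>

definition degree_functor ::
  "'o set \<Rightarrow> 'm set \<Rightarrow> ('m \<Rightarrow> 'o) \<Rightarrow> ('m \<Rightarrow> 'o) \<Rightarrow> ('m \<Rightarrow> 'm \<Rightarrow> 'm) \<Rightarrow> ('m \<Rightarrow> 'n::monoid_add) \<Rightarrow> bool"
  where
  "degree_functor Obj Mor r s cmp d \<longleftrightarrow>
     (\<forall>v\<in>Obj. \<forall>e. is_identity Mor r s cmp v e \<longrightarrow> d e = 0) \<and>
     (\<forall>\<mu>\<in>Mor. \<forall>\<nu>\<in>Mor. s \<mu> = r \<nu> \<longrightarrow> d (cmp \<mu> \<nu>) = d \<mu> + d \<nu>)"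

definition factorisation_property ::
  "'m set \<Rightarrow> ('m \<Rightarrow> 'o) \<Rightarrow> ('m \<Rightarrow> 'o) \<Rightarrow> ('m \<Rightarrow> 'm \<Rightarrow> 'm) \<Rightarrow> ('m \<Rightarrow> 'n::monoid_add) \<Rightarrow> bool" where
  "factorisation_property Mor r s cmp d \<longleftrightarrow>
     (\<forall>\<kappa>\<in>Mor. \<forall>m n. d \<kappa> = m + n \<longrightarrow>
        (\<exists>!(\<mu>, \<nu>). \<mu> \<in> Mor \<and> \<nu> \<in> Mor \<and> s \<mu> = r \<nu> \<and>
                   d \<mu> = m \<and> d \<nu> = n \<and> \<kappa> = cmp \<mu> \<nu>))"

locale two_graph = small_category Obj Mor r s cmp
  for Obj :: "'o set" and Mor :: "'m set"
    and r :: "'m \<Rightarrow> 'o" and s :: "'m \<Rightarrow> 'o"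
    and cmp :: "'m \<Rightarrow> 'm \<Rightarrow> 'm" +
  fixes d :: "'m \<Rightarrow> N2"
  assumes countable_Obj: "countable Obj"
    and countable_Mor: "countable Mor"
    and d_functor: "degree_functor Obj Mor r s cmp d"
    and d_factorisation: "factorisation_property Mor r s cmp d"

definition tile :: "N2 set \<Rightarrow> bool" where
  "tile T \<longleftrightarrow> T \<noteq> {} \<and> finite T \<and> (\<forall>n\<in>T. \<forall>m. m \<le> n \<longrightarrow> m \<in> T)"

definition nondegenerate :: "N2 set \<Rightarrow> bool" where
  "nondegenerate T \<longleftrightarrow> card T \<ge> 2"

definition corner1 :: "N2 set \<Rightarrow> N2" where
  "corner1 T = (Max (fst ` T), 0)"

definition corner2 :: "N2 set \<Rightarrow> N2" where
  "corner2 T = (0, Max (snd ` T))"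

definition punctured :: "N2 set \<Rightarrow> N2 set" where
  "punctured T = T - {corner1 T, corner2 T}"

locale basic_data =
  fixes T :: "N2 set" and A :: "'a set" and f :: "(N2 \<Rightarrow> 'a) \<Rightarrow> 'a \<Rightarrow> 'a"
  assumes tile: "tile T"
    and nondegenerate: "nondegenerate T"
    and finite_alphabet: "finite A"
    and nonempty_alphabet: "A \<noteq> {}"
    and bij: "p \<in> punctured T \<rightarrow>\<^sub>E A \<Longrightarrow> bij_betw (f p) A A"

definition vertex_fun :: "N2 set \<Rightarrow> ((N2 \<Rightarrow> 'a) \<Rightarrow> 'a \<Rightarrow> 'a) \<Rightarrow> (N2 \<Rightarrow> 'a) \<Rightarrow> 'a \<Rightarrow> N2 \<Rightarrow> 'a" where
  "vertex_fun T f p a = (\<lambda>t\<in>T. if t = corner2 T then a else if t = corner1 T then f p a else p t)"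

definition vertices :: "N2 set \<Rightarrow> 'a set \<Rightarrow> ((N2 \<Rightarrow> 'a) \<Rightarrow> 'a \<Rightarrow> 'a) \<Rightarrow> (N2 \<Rightarrow> 'a) set" where
  "vertices T A f = {vertex_fun T f p a | p a. p \<in> punctured T \<rightarrow>\<^sub>E A \<and> a \<in> A}"

definition translate :: "N2 set \<Rightarrow> N2 \<Rightarrow> N2 set" where
  "translate S n = (\<lambda>m. m + n) ` S"

definition tile_union :: "N2 set \<Rightarrow> N2 \<Rightarrow> N2 set" where
  "tile_union T n = (\<Union>m\<in>{..n}. translate T m)"

definition pull_back :: "N2 set \<Rightarrow> (N2 \<Rightarrow> 'a) \<Rightarrow> N2 \<Rightarrow> N2 \<Rightarrow> 'a" where
  "pull_back T g n = (\<lambda>i\<in>T. g (i + n))"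

text \<open>A path is a pair consisting of its degree and the underlying function; this makes the union
  over all degrees disjoint. Vertices are bare functions on \<open>T\<close>, so the path of degree 0 belonging
  to a vertex \<open>v\<close> is \<open>(0, v)\<close>.\<close>

type_synonym 'a path = "N2 \<times> (N2 \<Rightarrow> 'a)"

definition paths_of_degree ::
  "N2 set \<Rightarrow> 'a set \<Rightarrow> ((N2 \<Rightarrow> 'a) \<Rightarrow> 'a \<Rightarrow> 'a) \<Rightarrow> N2 \<Rightarrow> 'a path set" where
  "paths_of_degree T A f n =
     {(n, g) | g. g \<in> tile_union T n \<rightarrow>\<^sub>E A \<and> (\<forall>m\<le>n. pull_back T g m \<in> vertices T A f)}"

definition paths :: "N2 set \<Rightarrow> 'a set \<Rightarrow> ((N2 \<Rightarrow> 'a) \<Rightarrow> 'a \<Rightarrow> 'a) \<Rightarrow> 'a path set" where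
  "paths T A f = (\<Union>n. paths_of_degree T A f n)"

definition path_degree :: "'a path \<Rightarrow> N2" where
  "path_degree \<kappa> = fst \<kappa>"

definition range_of :: "N2 set \<Rightarrow> 'a path \<Rightarrow> N2 \<Rightarrow> 'a" where
  "range_of T \<kappa> = pull_back T (snd \<kappa>) 0"

definition source_of :: "N2 set \<Rightarrow> 'a path \<Rightarrow> N2 \<Rightarrow> 'a" where
  "source_of T \<kappa> = pull_back T (snd \<kappa>) (path_degree \<kappa>)"

text \<open>The path \<open>\<kappa>(m, n)\<close>, for \<open>m \<le> n \<le> path_degree \<kappa>\<close>.\<close>

definition segment :: "N2 set \<Rightarrow> 'a path \<Rightarrow> N2 \<Rightarrow> N2 \<Rightarrow> 'a path" where
  "segment T \<kappa> m n = (n - m, \<lambda>i\<in>tile_union T (n - m). snd \<kappa> (m + i))"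

definition is_composite ::
  "N2 set \<Rightarrow> 'a set \<Rightarrow> ((N2 \<Rightarrow> 'a) \<Rightarrow> 'a \<Rightarrow> 'a) \<Rightarrow> 'a path \<Rightarrow> 'a path \<Rightarrow> 'a path \<Rightarrow> bool" where
  "is_composite T A f \<mu> \<nu> \<kappa> \<longleftrightarrow>
     \<kappa> \<in> paths_of_degree T A f (path_degree \<mu> + path_degree \<nu>) \<and>
     segment T \<kappa> 0 (path_degree \<mu>) = \<mu> \<and>
     segment T \<kappa> (path_degree \<mu>) (path_degree \<mu> + path_degree \<nu>) = \<nu>"

definition compose_paths ::
  "N2 set \<Rightarrow> 'a set \<Rightarrow> ((N2 \<Rightarrow> 'a) \<Rightarrow> 'a \<Rightarrow> 'a) \<Rightarrow> 'a path \<Rightarrow> 'a path \<Rightarrow> 'a path" where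
  "compose_paths T A f \<mu> \<nu> = (THE \<kappa>. is_composite T A f \<mu> \<nu> \<kappa>)"

end

theory Submission
  imports Defs
begin

text \<open>Everything rests on the existence and uniqueness of composites. Let \<open>\<mu>\<close> have degree \<open>m\<close>,
  let \<open>\<nu>\<close> have degree \<open>n\<close>, and let the source of \<open>\<mu>\<close> be the range of \<open>\<nu>\<close>. Place \<open>\<nu>\<close> at position
  \<open>m\<close>. Because \<open>T\<close> is hereditary, the domains of \<open>\<mu>\<close> and of the shifted \<open>\<nu>\<close> meet exactly in the tile
  \<open>T + m\<close>, where the two functions agree, so that together they give an admissible labelling of all
  tiles at positions in \<open>{..m} \<union> {m..m + n}\<close> (\<open>overlapping_configurations_glue\<close>). What is missing
  in \<open>{..m + n}\<close> are two rectangles of positions, one to the lower right and one to the upper left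
  of \<open>m\<close>.

  These are filled position by position, moving away from \<open>m\<close>. If \<open>k\<close> lies to the lower right of
  \<open>m\<close> and its left and upper neighbours are present already, then every cell of \<open>T + k\<close> carries a
  label except the right-hand corner \<open>c\<^sub>1e\<^sub>1 + k\<close>: a cell in a higher row of \<open>T\<close> belongs to the tile at
  the upper neighbour, and a cell of the bottom row other than the corner to the tile at the left
  neighbour. The rule \<open>f\<^sub>p\<close> then gives the one admissible label of the corner. To the upper left of
  \<open>m\<close> the free cell is \<open>c\<^sub>2e\<^sub>2 + k\<close>, and its label is unique because \<open>f\<^sub>p\<close> is a bijection. So each
  added position extends the labelling in exactly one way (\<open>determines_insert_off_diagonal\<close>), and
  induction yields exactly one labelling of the whole box (\<open>box_pair_determines_box\<close>).

  Since a composite is characterised by its two segments, the category axioms and the factorisation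
  property reduce to the fact that a segment of a segment is a segment.\<close>

section \<open>Translates of a tile and segments of a path\<close>

lemma le_N2_iff: "(m::N2) \<le> n \<longleftrightarrow> fst m \<le> fst n \<and> snd m \<le> snd n"
  by (simp add: less_eq_prod_def)

lemma eq_N2_iff: "(m::N2) = n \<longleftrightarrow> fst m = fst n \<and> snd m = snd n"
  by (simp add: prod_eq_iff)

lemmas N2_simps = le_N2_iff eq_N2_iff

lemma finite_atMost_N2: "finite {..n::N2}"
proof -
  have "{..n} \<subseteq> {..fst n} \<times> {..snd n}" by (auto simp: le_N2_iff)
  then show ?thesis by (rule finite_subset) simp
qed

definition region :: "N2 set \<Rightarrow> N2 set \<Rightarrow> N2 set" where
  "region T K = (\<Union>k\<in>K. translate T k)"

lemma tile_union_region: "tile_union T n = region T {..n}"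
  by (simp add: tile_union_def region_def)

lemma mem_region_iff: "x \<in> region T K \<longleftrightarrow> (\<exists>k\<in>K. \<exists>t\<in>T. x = t + k)"
  by (auto simp: region_def translate_def)

lemma region_insert: "region T (insert k K) = translate T k \<union> region T K"
  by (simp add: region_def)

lemma region_Un: "region T (K \<union> L) = region T K \<union> region T L"
  by (auto simp: region_def)

lemma region_mono: "K \<subseteq> L \<Longrightarrow> region T K \<subseteq> region T L"
  by (auto simp: region_def)

lemma region_box_translate: "region T {m..m + n} = translate (region T {..n}) m"
proof (intro set_eqI iffI)
  fix x assume "x \<in> region T {m..m + n}"
  then obtain k t where k: "m \<le> k" "k \<le> m + n" and t: "t \<in> T" and x: "x = t + k"
    by (auto simp: mem_region_iff)
  have "k - m \<le> n" "x = (t + (k - m)) + m" using k x by (auto simp: N2_simps)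
  moreover have "t + (k - m) \<in> region T {..n}"
    using t \<open>k - m \<le> n\<close> by (auto simp: mem_region_iff)
  ultimately show "x \<in> translate (region T {..n}) m"
    unfolding translate_def by blast
next
  fix x assume "x \<in> translate (region T {..n}) m"
  then obtain k t where k: "k \<le> n" and t: "t \<in> T" and x: "x = (t + k) + m"
    by (auto simp: mem_region_iff translate_def)
  have "k + m \<in> {m..m + n}" "x = t + (k + m)" using k x by (auto simp: N2_simps)
  then show "x \<in> region T {m..m + n}" using t unfolding mem_region_iff by blast
qed

lemma region_zero: "region T {..0} = T"
proof -
  have "{..0::N2} = {0}" by (auto simp: N2_simps)
  then show ?thesis by (simp add: region_def translate_def)
qed

lemma pull_back_cong:
  "(\<And>t. t \<in> T \<Longrightarrow> g (t + k) = h (t + l)) \<Longrightarrow> pull_back T g k = pull_back T h l"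
  by (auto simp: pull_back_def fun_eq_iff)

lemma segment_pull_back: "segment T \<kappa> m n = (n - m, pull_back (region T {..n - m}) (snd \<kappa>) m)"
  by (simp add: segment_def pull_back_def tile_union_region add.commute)

lemma segment_segment:
  assumes "p \<le> q" "m + q \<le> n"
  shows "segment T (segment T \<kappa> m n) p q = segment T \<kappa> (m + p) (m + q)"
proof -
  have q: "(m + q) - (m + p) = q - p" by (auto simp: N2_simps)
  have "i + p \<in> region T {..n - m}" if i: "i \<in> region T {..q - p}" for i
  proof -
    obtain k t where k: "k \<le> q - p" and t: "t \<in> T" and x: "i = t + k"
      using i by (auto simp: mem_region_iff)
    have "k + p \<in> {..n - m}" "i + p = t + (k + p)" using k x assms by (auto simp: N2_simps)
    then show ?thesis using t unfolding mem_region_iff by blast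
  qed
  then show ?thesis
    unfolding segment_pull_back q by (auto simp: pull_back_def fun_eq_iff ac_simps)
qed

section \<open>Labellings on arbitrary sets of positions\<close>

text \<open>Paths of degree \<open>n\<close> are the case \<open>K = {..n}\<close>. More general sets \<open>K\<close> are needed for the
  intermediate stages of the construction of a composite, which live on sets of positions that are
  not boxes.\<close>

definition configurations ::
  "N2 set \<Rightarrow> 'a set \<Rightarrow> ((N2 \<Rightarrow> 'a) \<Rightarrow> 'a \<Rightarrow> 'a) \<Rightarrow> N2 set \<Rightarrow> (N2 \<Rightarrow> 'a) set" where
  "configurations T A f K =
     {g \<in> region T K \<rightarrow>\<^sub>E A. \<forall>k\<in>K. pull_back T g k \<in> vertices T A f}"

lemma mem_paths_of_degree_iff:
  "\<kappa> \<in> paths_of_degree T A f n \<longleftrightarrow> fst \<kappa> = n \<and> snd \<kappa> \<in> configurations T A f {..n}"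
  by (cases \<kappa>) (auto simp: paths_of_degree_def configurations_def tile_union_region)

lemma mem_paths_iff: "\<kappa> \<in> paths T A f \<longleftrightarrow> snd \<kappa> \<in> configurations T A f {..fst \<kappa>}"
  by (auto simp: paths_def mem_paths_of_degree_iff)

lemma segment_in_paths:
  assumes \<kappa>: "\<kappa> \<in> paths T A f" and mn: "m \<le> n" "n \<le> path_degree \<kappa>"
  shows "segment T \<kappa> m n \<in> paths T A f"
    and "range_of T (segment T \<kappa> m n) = pull_back T (snd \<kappa>) m"
    and "source_of T (segment T \<kappa> m n) = pull_back T (snd \<kappa>) n"
proof -
  let ?R = "region T {..n - m}"
  let ?g = "pull_back ?R (snd \<kappa>) m"
  have in_R: "t + k \<in> ?R" if "t \<in> T" "k \<le> n - m" for t k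
    using that by (auto simp: mem_region_iff)
  have pb: "pull_back T ?g k = pull_back T (snd \<kappa>) (k + m)" if "k \<le> n - m" for k
    by (rule pull_back_cong) (use in_R[OF _ that] in \<open>simp add: pull_back_def ac_simps\<close>)
  have conf: "snd \<kappa> \<in> region T {..fst \<kappa>} \<rightarrow>\<^sub>E A"
    and v: "\<And>k. k \<le> fst \<kappa> \<Longrightarrow> pull_back T (snd \<kappa>) k \<in> vertices T A f"
    using \<kappa> by (auto simp: mem_paths_iff configurations_def)
  have "x + m \<in> region T {..fst \<kappa>}" if x: "x \<in> ?R" for x
  proof -
    obtain k t where k: "k \<le> n - m" and t: "t \<in> T" and x: "x = t + k"
      using x by (auto simp: mem_region_iff)
    have "k + m \<in> {..fst \<kappa>}" "x + m = t + (k + m)"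
      using k x mn by (auto simp: N2_simps path_degree_def)
    then show ?thesis using t unfolding mem_region_iff by blast
  qed
  then have "?g \<in> ?R \<rightarrow>\<^sub>E A" using conf by (auto simp: pull_back_def)
  moreover have "pull_back T ?g k \<in> vertices T A f" if "k \<le> n - m" for k
  proof -
    have "k + m \<le> fst \<kappa>" using that mn by (auto simp: N2_simps path_degree_def)
    then show ?thesis using v pb[OF that] by simp
  qed
  ultimately show "segment T \<kappa> m n \<in> paths T A f"
    by (simp add: mem_paths_iff segment_pull_back configurations_def)
  show "range_of T (segment T \<kappa> m n) = pull_back T (snd \<kappa>) m"
    using pb[of 0] by (simp add: range_of_def segment_pull_back N2_simps)
  have "n - m + m = n" using mn by (auto simp: N2_simps)
  then show "source_of T (segment T \<kappa> m n) = pull_back T (snd \<kappa>) n"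
    using pb[of "n - m"] by (simp add: source_of_def segment_pull_back path_degree_def)
qed

lemma segment_degree: "path_degree (segment T \<kappa> m n) = n - m"
  by (simp add: segment_def path_degree_def)

lemma segment_whole:
  assumes "\<kappa> \<in> paths T A f"
  shows "segment T \<kappa> 0 (path_degree \<kappa>) = \<kappa>"
proof -
  have "restrict (snd \<kappa>) (region T {..fst \<kappa>}) = snd \<kappa>"
    using assms by (auto simp: mem_paths_iff configurations_def intro: extensional_restrict)
  then show ?thesis
    by (simp add: segment_pull_back pull_back_def path_degree_def)
qed

text \<open>The assertion about composites, in a form that is transitive in the sets of positions and can
  therefore be built up one position at a time.\<close>

definition determines ::
  "N2 set \<Rightarrow> 'a set \<Rightarrow> ((N2 \<Rightarrow> 'a) \<Rightarrow> 'a \<Rightarrow> 'a) \<Rightarrow> N2 set \<Rightarrow> N2 set \<Rightarrow> bool" where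
  "determines T A f K L \<longleftrightarrow>
     (\<forall>g\<in>configurations T A f K. \<exists>!h. h \<in> configurations T A f L \<and> restrict h (region T K) = g)"

lemma configurations_restrict:
  assumes h: "h \<in> configurations T A f L" and "K \<subseteq> L"
  shows "restrict h (region T K) \<in> configurations T A f K"
proof -
  have "pull_back T (restrict h (region T K)) k = pull_back T h k" if "k \<in> K" for k
    by (rule pull_back_cong) (use that in \<open>auto simp: mem_region_iff\<close>)
  then show ?thesis
    using assms region_mono[OF \<open>K \<subseteq> L\<close>, of T] by (auto simp: configurations_def)
qed

lemma determines_refl: "determines T A f K K"
  unfolding determines_def
proof
  fix g assume "g \<in> configurations T A f K"
  moreover have "restrict h (region T K) = h" if "h \<in> configurations T A f K" for h
    using that by (auto simp: configurations_def intro: extensional_restrict)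
  ultimately show "\<exists>!h. h \<in> configurations T A f K \<and> restrict h (region T K) = g"
    by metis
qed

lemma determines_trans:
  assumes KL: "determines T A f K L" and LM: "determines T A f L M"
    and sub: "K \<subseteq> L" "L \<subseteq> M"
  shows "determines T A f K M"
  unfolding determines_def
proof
  fix g assume "g \<in> configurations T A f K"
  then obtain h where h: "h \<in> configurations T A f L" "restrict h (region T K) = g"
    and h_unique: "\<And>h'. h' \<in> configurations T A f L \<Longrightarrow> restrict h' (region T K) = g \<Longrightarrow> h' = h"
    using KL unfolding determines_def by metis
  obtain j where j: "j \<in> configurations T A f M" "restrict j (region T L) = h"
    and j_unique: "\<And>j'. j' \<in> configurations T A f M \<Longrightarrow> restrict j' (region T L) = h \<Longrightarrow> j' = j"
    using LM h(1) unfolding determines_def by metis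
  have two_step: "restrict (restrict j' (region T L)) (region T K) = restrict j' (region T K)" for j'
    using region_mono[OF sub(1), of T] by (auto simp: fun_eq_iff)
  show "\<exists>!j. j \<in> configurations T A f M \<and> restrict j (region T K) = g"
  proof (rule ex1I[of _ j])
    show "j \<in> configurations T A f M \<and> restrict j (region T K) = g"
      using j h two_step by metis
  next
    fix j' assume j': "j' \<in> configurations T A f M \<and> restrict j' (region T K) = g"
    then have "restrict j' (region T L) = h"
      using h_unique two_step configurations_restrict[OF _ sub(2)] by metis
    then show "j' = j" using j' j_unique by blast
  qed
qed

section \<open>Filling a box one position at a time\<close>

text \<open>Membership of \<open>y\<close> in the rectangle spanned by \<open>m\<close> and \<open>x\<close>, in whatever direction \<open>x\<close> lies
  from \<open>m\<close>.\<close>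

definition between :: "N2 \<Rightarrow> N2 \<Rightarrow> N2 \<Rightarrow> bool" where
  "between m y x \<longleftrightarrow> (fst y \<in> {min (fst m) (fst x)..max (fst m) (fst x)} \<and>
     snd y \<in> {min (snd m) (snd x)..max (snd m) (snd x)})"

text \<open>This is the invariant of the filling procedure: it makes precise that the two missing
  rectangles are filled outwards from \<open>m\<close>.\<close>

definition star_shaped :: "N2 \<Rightarrow> N2 set \<Rightarrow> bool" where
  "star_shaped m K \<longleftrightarrow> (\<forall>x\<in>K. \<forall>y. between m y x \<longrightarrow> y \<in> K)"

context basic_data
begin

lemma hereditary: "n \<in> T \<Longrightarrow> m \<le> n \<Longrightarrow> m \<in> T"
  using tile unfolding tile_def by blast

lemma finite_T: "finite T" and T_nonempty: "T \<noteq> {}"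
  using tile unfolding tile_def by auto

lemma corner1_in_T: "corner1 T \<in> T"
proof -
  have "Max (fst ` T) \<in> fst ` T" using finite_T T_nonempty by simp
  then obtain t where "t \<in> T" "fst t = Max (fst ` T)" by auto
  then show ?thesis using hereditary[of t "corner1 T"] by (simp add: corner1_def le_N2_iff)
qed

lemma corner2_in_T: "corner2 T \<in> T"
proof -
  have "Max (snd ` T) \<in> snd ` T" using finite_T T_nonempty by simp
  then obtain t where "t \<in> T" "snd t = Max (snd ` T)" by auto
  then show ?thesis using hereditary[of t "corner2 T"] by (simp add: corner2_def le_N2_iff)
qed

lemma le_corners: "t \<in> T \<Longrightarrow> fst t \<le> fst (corner1 T) \<and> snd t \<le> snd (corner2 T)"
  using finite_T by (auto simp: corner1_def corner2_def)

text \<open>If the corners coincided, both would be the origin, and \<open>T\<close> would be a single cell.\<close>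

lemma corners_distinct: "corner1 T \<noteq> corner2 T"
proof
  assume "corner1 T = corner2 T"
  then have "T \<subseteq> {0}"
    using le_corners by (auto simp: corner1_def corner2_def N2_simps)
  then have "card T \<le> 1" using card_mono[of "{0::N2}" T] by simp
  then show False using nondegenerate by (simp add: nondegenerate_def)
qed

text \<open>The vertices are the solutions of one equation between the labels of the two corners, with
  the remaining labels as parameter.\<close>

lemma vertices_iff:
  "v \<in> vertices T A f \<longleftrightarrow>
     v \<in> T \<rightarrow>\<^sub>E A \<and> v (corner1 T) = f (restrict v (punctured T)) (v (corner2 T))"
proof
  assume "v \<in> vertices T A f"
  then obtain p a where p: "p \<in> punctured T \<rightarrow>\<^sub>E A" and a: "a \<in> A" and v: "v = vertex_fun T f p a"
    by (auto simp: vertices_def)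
  have "f p a \<in> A" using bij[OF p] a by (rule bij_betw_apply)
  moreover have pA: "p t \<in> A" if "t \<in> T" "t \<noteq> corner1 T" "t \<noteq> corner2 T" for t
    by (rule PiE_mem[OF p]) (simp add: punctured_def that)
  ultimately have "v \<in> T \<rightarrow>\<^sub>E A"
    using a by (auto simp: v vertex_fun_def)
  moreover have "restrict v (punctured T) = p"
  proof
    fix t show "restrict v (punctured T) t = p t"
    proof (cases "t \<in> punctured T")
      case True
      then show ?thesis by (simp add: v vertex_fun_def) (simp add: punctured_def)
    next
      case False
      then show ?thesis using PiE_arb[OF p] by simp
    qed
  qed
  ultimately show "v \<in> T \<rightarrow>\<^sub>E A \<and> v (corner1 T) = f (restrict v (punctured T)) (v (corner2 T))"
    using corner1_in_T corner2_in_T corners_distinct by (simp add: v vertex_fun_def)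
next
  assume v: "v \<in> T \<rightarrow>\<^sub>E A \<and> v (corner1 T) = f (restrict v (punctured T)) (v (corner2 T))"
  then have "restrict v (punctured T) \<in> punctured T \<rightarrow>\<^sub>E A" "v (corner2 T) \<in> A"
    using corner2_in_T by (auto simp: punctured_def)
  moreover have "v = vertex_fun T f (restrict v (punctured T)) (v (corner2 T))"
    using v by (auto simp: vertex_fun_def punctured_def fun_eq_iff PiE_def extensional_def)
  ultimately show "v \<in> vertices T A f" unfolding vertices_def by blast
qed

text \<open>The equation for a vertex can be solved for the label of either corner: at \<open>corner1 T\<close> by
  applying \<open>f p\<close>, at \<open>corner2 T\<close> by inverting it. The statement treats the two corners alike, so
  that the extension argument can be carried out for both at once.\<close>

lemma vertex_determined_at_corner:
  assumes c: "c \<in> {corner1 T, corner2 T}" and w: "\<And>t. t \<in> T - {c} \<Longrightarrow> w t \<in> A"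
  shows "\<exists>!a. a \<in> A \<and> restrict (w(c := a)) T \<in> vertices T A f"
proof -
  let ?p = "restrict w (punctured T)"
  have p: "?p \<in> punctured T \<rightarrow>\<^sub>E A" using w c by (auto simp: punctured_def)
  note bij = bij[OF p]
  have p': "restrict (restrict (w(c := a)) T) (punctured T) = ?p" for a
    using c by (auto simp: punctured_def fun_eq_iff)
  have mem: "restrict (w(c := a)) T \<in> T \<rightarrow>\<^sub>E A" if "a \<in> A" for a
    using that w by auto
  show ?thesis
  proof (cases "c = corner1 T")
    case True
    have "w (corner2 T) \<in> A" using w corner2_in_T corners_distinct True by auto
    then have "f ?p (w (corner2 T)) \<in> A" using bij by (rule bij_betw_apply[rotated])
    moreover have "restrict (w(c := a)) T \<in> vertices T A f \<longleftrightarrow> a = f ?p (w (corner2 T))" if "a \<in> A" for a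
      using mem[OF that] corner1_in_T corner2_in_T corners_distinct True
      unfolding vertices_iff p' by auto
    ultimately show ?thesis by blast
  next
    case False
    then have c2: "c = corner2 T" using c by blast
    have w1: "w (corner1 T) \<in> A" using w corner1_in_T corners_distinct c2 by auto
    have "restrict (w(c := a)) T \<in> vertices T A f \<longleftrightarrow> f ?p a = w (corner1 T)" if "a \<in> A" for a
      using mem[OF that] corner1_in_T corner2_in_T corners_distinct c2
      unfolding vertices_iff p' by auto
    moreover have "\<exists>!a. a \<in> A \<and> f ?p a = w (corner1 T)"
    proof -
      have "w (corner1 T) \<in> f ?p ` A" using bij w1 by (simp add: bij_betw_def)
      then obtain b where "b \<in> A" "f ?p b = w (corner1 T)" by auto
      moreover have "inj_on (f ?p) A" using bij by (simp add: bij_betw_def)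
      ultimately show ?thesis by (metis inj_onD)
    qed
    ultimately show ?thesis by blast
  qed
qed

text \<open>The tile at the new position \<open>k\<close> has a single unlabelled cell, which is one of its corners.
  Labelling that cell leaves the tiles at positions of \<open>K\<close> untouched, so the only constraint on the
  label comes from the tile at \<open>k\<close>.\<close>

lemma determines_insert:
  assumes c: "c \<in> {corner1 T, corner2 T}"
    and known: "\<And>t. t \<in> T - {c} \<Longrightarrow> t + k \<in> region T K"
    and new: "c + k \<notin> region T K"
  shows "determines T A f K (insert k K)"
  unfolding determines_def
proof
  fix g assume g: "g \<in> configurations T A f K"
  have c_T: "c \<in> T" using c corner1_in_T corner2_in_T by blast
  have reg: "region T (insert k K) = insert (c + k) (region T K)"
  proof -
    have "translate T k = insert (c + k) (translate (T - {c}) k)"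
      using c_T unfolding translate_def by blast
    moreover have "translate (T - {c}) k \<subseteq> region T K"
      using known unfolding translate_def by blast
    ultimately show ?thesis unfolding region_insert by blast
  qed
  define w where "w t = g (t + k)" for t
  have wA: "w t \<in> A" if "t \<in> T - {c}" for t
    using g known[OF that] by (auto simp: w_def configurations_def)
  have pb_k: "pull_back T (g(c + k := a)) k = restrict (w(c := a)) T" for a
    by (auto simp: pull_back_def w_def fun_eq_iff)
  have pb_K: "pull_back T (g(c + k := a)) j = pull_back T g j" if "j \<in> K" for a j
  proof (rule pull_back_cong)
    fix t assume "t \<in> T"
    then have "t + j \<noteq> c + k" using new that by (metis mem_region_iff)
    then show "(g(c + k := a)) (t + j) = g (t + j)" by simp
  qed
  have conf_iff: "g(c + k := a) \<in> configurations T A f (insert k K) \<longleftrightarrow>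
      a \<in> A \<and> restrict (w(c := a)) T \<in> vertices T A f" for a
  proof -
    have "g(c + k := a) \<in> insert (c + k) (region T K) \<rightarrow>\<^sub>E A \<longleftrightarrow> a \<in> A"
      using g by (auto simp: configurations_def PiE_iff extensional_def)
    then show ?thesis
      using g pb_k pb_K by (auto simp: configurations_def reg)
  qed
  have restrict_eq: "restrict (g(c + k := a)) (region T K) = g" for a
    using g new by (auto simp: configurations_def fun_eq_iff PiE_def extensional_def)
  have update_form: "h = g(c + k := h (c + k))"
    if h: "h \<in> configurations T A f (insert k K)" and eq: "restrict h (region T K) = g" for h
  proof
    fix x
    have "h x = undefined" if "x \<notin> insert (c + k) (region T K)"
      using h PiE_arb[OF _ that] unfolding configurations_def reg by blast
    then show "h x = (g(c + k := h (c + k))) x"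
      unfolding eq[symmetric] by (cases "x \<in> region T K") auto
  qed
  have "\<exists>!a. a \<in> A \<and> restrict (w(c := a)) T \<in> vertices T A f"
    by (rule vertex_determined_at_corner[OF c]) (rule wA)
  then obtain a where a: "a \<in> A \<and> restrict (w(c := a)) T \<in> vertices T A f"
    and a_unique: "\<And>b. b \<in> A \<and> restrict (w(c := b)) T \<in> vertices T A f \<Longrightarrow> b = a"
    by (elim ex1E) blast
  show "\<exists>!h. h \<in> configurations T A f (insert k K) \<and> restrict h (region T K) = g"
  proof (rule ex1I[of _ "g(c + k := a)"])
    show "g(c + k := a) \<in> configurations T A f (insert k K) \<and>
        restrict (g(c + k := a)) (region T K) = g"
      using a conf_iff restrict_eq by blast
  next
    fix h assume h: "h \<in> configurations T A f (insert k K) \<and> restrict h (region T K) = g"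
    then have eq: "h = g(c + k := h (c + k))" using update_form by blast
    then have "g(c + k := h (c + k)) \<in> configurations T A f (insert k K)" using h by simp
    then have "h (c + k) = a" unfolding conf_iff by (rule a_unique)
    then show "h = g(c + k := a)" using eq by simp
  qed
qed

text \<open>To the lower right of \<open>m\<close> the free cell of the new tile is its first corner, to the upper left
  its second corner. That this cell is unlabelled follows from star-shapedness: a tile at \<open>j\<close> that
  contained it would have \<open>j\<close> at or beyond \<open>k\<close> as seen from \<open>m\<close>, and then \<open>k\<close> would already be
  present.\<close>

lemma determines_insert_off_diagonal:
  assumes star: "star_shaped m K" and "k \<notin> K"
    and near: "\<And>y. between m y k \<Longrightarrow> y \<noteq> k \<Longrightarrow> y \<in> K"
    and k: "fst m < fst k \<and> snd k < snd m \<or> fst k < fst m \<and> snd m < snd k"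
  shows "determines T A f K (insert k K)"
proof -
  have not_beyond: "\<not> between m k j" if "j \<in> K" for j
    using star \<open>k \<notin> K\<close> that unfolding star_shaped_def by blast
  from k show ?thesis
  proof
    assume k: "fst m < fst k \<and> snd k < snd m"
    have K: "k + (0, 1) \<in> K" "k - (1, 0) \<in> K"
      using k by (auto intro!: near simp: between_def N2_simps)
    show ?thesis
    proof (rule determines_insert[of "corner1 T"])
      fix t assume t: "t \<in> T - {corner1 T}"
      show "t + k \<in> region T K"
      proof (cases "snd t = 0")
        case True
        have "fst t \<le> fst (corner1 T)" using le_corners t by blast
        moreover have "fst t \<noteq> fst (corner1 T)"
          using t True by (auto simp: corner1_def N2_simps)
        ultimately have "t + (1, 0) \<in> T"
          using True by (intro hereditary[OF corner1_in_T]) (auto simp: N2_simps)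
        moreover have "t + k = (t + (1, 0)) + (k - (1, 0))" using k by (auto simp: N2_simps)
        ultimately show ?thesis using K unfolding mem_region_iff by blast
      next
        case False
        have "t - (0, 1) \<in> T" using t hereditary[of t "t - (0, 1)"] by (simp add: le_N2_iff)
        moreover have "t + k = (t - (0, 1)) + (k + (0, 1))" using False by (auto simp: N2_simps)
        ultimately show ?thesis using K unfolding mem_region_iff by blast
      qed
    next
      show "corner1 T + k \<notin> region T K"
      proof
        assume "corner1 T + k \<in> region T K"
        then obtain j t where j: "j \<in> K" and t: "t \<in> T" and eq: "corner1 T + k = t + j"
          unfolding mem_region_iff by blast
        have "fst k \<le> fst j" "snd j \<le> snd k"
          using le_corners[OF t] eq by (auto simp: N2_simps corner1_def)
        then have "between m k j" using k by (auto simp: between_def)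
        then show False using not_beyond j by blast
      qed
    qed simp
  next
    assume k: "fst k < fst m \<and> snd m < snd k"
    have K: "k + (1, 0) \<in> K" "k - (0, 1) \<in> K"
      using k by (auto intro!: near simp: between_def N2_simps)
    show ?thesis
    proof (rule determines_insert[of "corner2 T"])
      fix t assume t: "t \<in> T - {corner2 T}"
      show "t + k \<in> region T K"
      proof (cases "fst t = 0")
        case True
        have "snd t \<le> snd (corner2 T)" using le_corners t by blast
        moreover have "snd t \<noteq> snd (corner2 T)"
          using t True by (auto simp: corner2_def N2_simps)
        ultimately have "t + (0, 1) \<in> T"
          using True by (intro hereditary[OF corner2_in_T]) (auto simp: N2_simps)
        moreover have "t + k = (t + (0, 1)) + (k - (0, 1))" using k by (auto simp: N2_simps)
        ultimately show ?thesis using K unfolding mem_region_iff by blast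
      next
        case False
        have "t - (1, 0) \<in> T" using t hereditary[of t "t - (1, 0)"] by (simp add: le_N2_iff)
        moreover have "t + k = (t - (1, 0)) + (k + (1, 0))" using False by (auto simp: N2_simps)
        ultimately show ?thesis using K unfolding mem_region_iff by blast
      qed
    next
      show "corner2 T + k \<notin> region T K"
      proof
        assume "corner2 T + k \<in> region T K"
        then obtain j t where j: "j \<in> K" and t: "t \<in> T" and eq: "corner2 T + k = t + j"
          unfolding mem_region_iff by blast
        have "snd k \<le> snd j" "fst j \<le> fst k"
          using le_corners[OF t] eq by (auto simp: N2_simps corner2_def)
        then have "between m k j" using k by (auto simp: between_def)
        then show False using not_beyond j by blast
      qed
    qed simp
  qed
qed

text \<open>A missing position that is closest to \<open>m\<close> can be added without destroying star-shapedness.\<close>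

lemma star_shaped_determines_box:
  assumes "star_shaped m K" "{..m} \<union> {m..m + n} \<subseteq> K" "K \<subseteq> {..m + n}"
  shows "determines T A f K {..m + n}"
  using assms
proof (induction "card ({..m + n} - K)" arbitrary: K rule: less_induct)
  case less
  show ?case
  proof (cases "K = {..m + n}")
    case True
    then show ?thesis by (simp add: determines_refl)
  next
    case False
    \<comment> \<open>the \<open>\<ell>\<^sup>1\<close>-distance from \<open>m\<close>, each absolute value being a sum of two truncated differences\<close>
    define \<delta> where "\<delta> x = (fst x - fst m) + (fst m - fst x) + (snd x - snd m) + (snd m - snd x)" for x :: N2
    obtain x where "x \<in> {..m + n} - K" using False less.prems(3) by blast
    then obtain k where k: "k \<in> {..m + n} - K"
      and k_min: "\<And>y. y \<in> {..m + n} - K \<Longrightarrow> \<delta> k \<le> \<delta> y"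
      using ex_has_least_nat[of "\<lambda>x. x \<in> {..m + n} - K" x \<delta>] by blast
    have near: "y \<in> K" if y: "between m y k" "y \<noteq> k" for y
    proof (rule ccontr)
      assume "y \<notin> K"
      moreover have "y \<le> m + n" using y k by (auto simp: between_def N2_simps)
      ultimately have "\<delta> k \<le> \<delta> y" using k_min by blast
      then show False using y by (auto simp: between_def N2_simps \<delta>_def min_def max_def split: if_splits)
    qed
    \<comment> \<open>a position comparable to \<open>m\<close> lies in one of the two given boxes\<close>
    have "\<not> k \<le> m" "\<not> m \<le> k" using k less.prems(2) by auto
    then have off: "fst m < fst k \<and> snd k < snd m \<or> fst k < fst m \<and> snd m < snd k"
      by (auto simp: N2_simps)
    have step: "determines T A f K (insert k K)"
      by (rule determines_insert_off_diagonal[OF less.prems(1) _ near off]) (use k in auto)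
    have "star_shaped m (insert k K)"
      using less.prems(1) near unfolding star_shaped_def by blast
    moreover have "card ({..m + n} - insert k K) < card ({..m + n} - K)"
      using k by (intro psubset_card_mono) (auto intro: finite_atMost_N2)
    ultimately have "determines T A f (insert k K) {..m + n}"
      using less.hyps[of "insert k K"] less.prems k by auto
    then show ?thesis using determines_trans[OF step] k less.prems(3) by auto
  qed
qed

lemma box_pair_determines_box: "determines T A f ({..m} \<union> {m..m + n}) {..m + n}"
  by (rule star_shaped_determines_box[OF _ order_refl])
    (auto simp: star_shaped_def between_def N2_simps)

section \<open>Existence and uniqueness of composites\<close>

text \<open>If \<open>x + m = t + k\<close> with \<open>k \<le> m\<close>, then \<open>x \<le> t\<close>, and \<open>T\<close> is hereditary. Hence two boxes that
  meet at the position \<open>m\<close> share no cells beyond those of the tile at \<open>m\<close>.\<close>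

lemma overlap_in_tile:
  assumes "x + m \<in> region T {..m}"
  shows "x \<in> T"
proof -
  obtain k t where k: "k \<le> m" and t: "t \<in> T" and eq: "x + m = t + k"
    using assms unfolding mem_region_iff by auto
  have "x \<le> t" using k eq by (auto simp: N2_simps)
  then show ?thesis using t hereditary by blast
qed

lemma overlapping_configurations_glue:
  assumes g: "g \<in> configurations T A f {..m}" and h: "h \<in> configurations T A f {..n}"
    and agree: "pull_back T g m = pull_back T h 0"
  shows "\<exists>j\<in>configurations T A f ({..m} \<union> {m..m + n}).
    (\<forall>x\<in>region T {..m}. j x = g x) \<and> (\<forall>x\<in>region T {..n}. j (x + m) = h x)"
proof -
  let ?U = "region T ({..m} \<union> {m..m + n})"
  define j where "j = (\<lambda>x\<in>?U. if x \<in> region T {..m} then g x else h (x - m))"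
  have U: "?U = region T {..m} \<union> translate (region T {..n}) m"
    by (simp add: region_Un region_box_translate)
  have j1: "j x = g x" if "x \<in> region T {..m}" for x
    using that by (simp add: j_def U)
  have j2: "j (x + m) = h x" if x: "x \<in> region T {..n}" for x
  proof (cases "x + m \<in> region T {..m}")
    case True
    then have "x \<in> T" by (rule overlap_in_tile)
    then have "g (x + m) = h x"
      using fun_cong[OF agree, of x] by (simp add: pull_back_def)
    then show ?thesis using j1 True by simp
  next
    case False
    then show ?thesis using x by (simp add: j_def U translate_def)
  qed
  have "j x \<in> A" if x: "x \<in> ?U" for x
  proof -
    have gA: "g y \<in> A" if "y \<in> region T {..m}" for y
      using g that by (auto simp: configurations_def)
    have hA: "h y \<in> A" if "y \<in> region T {..n}" for y
      using h that by (auto simp: configurations_def)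
    consider "x \<in> region T {..m}" | y where "y \<in> region T {..n}" "x = y + m"
      using x unfolding U translate_def by blast
    then show ?thesis using gA hA j1 j2 by cases simp_all
  qed
  then have "j \<in> ?U \<rightarrow>\<^sub>E A" by (auto simp: j_def)
  moreover have "pull_back T j k \<in> vertices T A f" if k: "k \<in> {..m} \<union> {m..m + n}" for k
    using k
  proof
    assume k: "k \<in> {..m}"
    have "pull_back T j k = pull_back T g k"
      by (rule pull_back_cong, rule j1) (use k in \<open>auto simp: mem_region_iff\<close>)
    then show ?thesis using g k by (simp add: configurations_def)
  next
    assume k: "k \<in> {m..m + n}"
    have km: "k - m \<le> n" "k = (k - m) + m" using k by (auto simp: N2_simps)
    have "pull_back T j k = pull_back T h (k - m)"
    proof (rule pull_back_cong)
      fix t assume "t \<in> T"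
      then have "t + (k - m) \<in> region T {..n}" using km by (auto simp: mem_region_iff)
      from j2[OF this] show "j (t + k) = h (t + (k - m))" using km(2) by (simp add: add.assoc)
    qed
    then show ?thesis using h km by (simp add: configurations_def)
  qed
  ultimately have "j \<in> configurations T A f ({..m} \<union> {m..m + n})"
    by (simp add: configurations_def)
  then show ?thesis using j1 j2 by blast
qed

text \<open>A composite of \<open>\<mu>\<close> and \<open>\<nu>\<close> is the same as an extension to the box \<open>{..m + n}\<close> of the labelling
  glued from \<open>\<mu>\<close> and the shifted \<open>\<nu>\<close>, and such an extension exists and is unique.\<close>

lemma ex1_composite:
  assumes \<mu>: "\<mu> \<in> paths T A f" and \<nu>: "\<nu> \<in> paths T A f" and eq: "source_of T \<mu> = range_of T \<nu>"
  shows "\<exists>!\<kappa>. is_composite T A f \<mu> \<nu> \<kappa>"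
proof -
  obtain m g n h where mg: "\<mu> = (m, g)" and nh: "\<nu> = (n, h)" by (metis surj_pair)
  have g: "g \<in> configurations T A f {..m}" and h: "h \<in> configurations T A f {..n}"
    using \<mu> \<nu> by (auto simp: mg nh mem_paths_iff)
  have "pull_back T g m = pull_back T h 0"
    using eq by (simp add: mg nh source_of_def range_of_def path_degree_def)
  then obtain j where j: "j \<in> configurations T A f ({..m} \<union> {m..m + n})"
    and j1: "\<And>x. x \<in> region T {..m} \<Longrightarrow> j x = g x"
    and j2: "\<And>x. x \<in> region T {..n} \<Longrightarrow> j (x + m) = h x"
    using overlapping_configurations_glue[OF g h] by blast
  let ?U = "region T ({..m} \<union> {m..m + n})"
  have U: "?U = region T {..m} \<union> translate (region T {..n}) m"
    by (simp add: region_Un region_box_translate)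
  have composite_iff: "is_composite T A f \<mu> \<nu> \<kappa> \<longleftrightarrow>
      fst \<kappa> = m + n \<and> snd \<kappa> \<in> configurations T A f {..m + n} \<and> restrict (snd \<kappa>) ?U = j" for \<kappa>
  proof -
    have ext: "g \<in> extensional (region T {..m})" "h \<in> extensional (region T {..n})"
      "j \<in> extensional ?U"
      using g h j by (auto simp: configurations_def PiE_def)
    have diff: "(m + n) - m = n" by (auto simp: N2_simps)
    have "segment T \<kappa> 0 m = \<mu> \<longleftrightarrow> (\<forall>x\<in>region T {..m}. snd \<kappa> x = g x)"
      using ext(1) by (auto simp: segment_pull_back mg pull_back_def fun_eq_iff extensional_def)
    moreover have "segment T \<kappa> m (m + n) = \<nu> \<longleftrightarrow> (\<forall>x\<in>region T {..n}. snd \<kappa> (x + m) = h x)"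
      using ext(2) by (auto simp: segment_pull_back nh diff pull_back_def fun_eq_iff extensional_def)
    moreover have "restrict (snd \<kappa>) ?U = j \<longleftrightarrow> (\<forall>x\<in>?U. snd \<kappa> x = j x)"
      using ext(3) by (auto simp: fun_eq_iff extensional_def)
    moreover have "\<dots> \<longleftrightarrow> (\<forall>x\<in>region T {..m}. snd \<kappa> x = g x) \<and>
        (\<forall>x\<in>region T {..n}. snd \<kappa> (x + m) = h x)"
      using j1 j2 by (auto simp: U translate_def)
    ultimately show ?thesis
      by (auto simp: is_composite_def mem_paths_of_degree_iff path_degree_def mg nh)
  qed
  have "\<exists>!l. l \<in> configurations T A f {..m + n} \<and> restrict l ?U = j"
    using box_pair_determines_box j unfolding determines_def by blast
  then obtain l where l: "l \<in> configurations T A f {..m + n} \<and> restrict l ?U = j"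
    and l_unique: "\<And>l'. l' \<in> configurations T A f {..m + n} \<and> restrict l' ?U = j \<Longrightarrow> l' = l"
    by metis
  show ?thesis
  proof (rule ex1I[of _ "(m + n, l)"])
    show "is_composite T A f \<mu> \<nu> (m + n, l)" using l by (simp add: composite_iff)
  next
    fix \<kappa> assume "is_composite T A f \<mu> \<nu> \<kappa>"
    then show "\<kappa> = (m + n, l)" using l_unique by (cases \<kappa>) (simp add: composite_iff)
  qed
qed

section \<open>The category of paths and its degree functor\<close>

lemma is_composite_compose_paths:
  assumes "\<mu> \<in> paths T A f" "\<nu> \<in> paths T A f" "source_of T \<mu> = range_of T \<nu>"
  shows "is_composite T A f \<mu> \<nu> (compose_paths T A f \<mu> \<nu>)"
proof -
  from theI'[OF ex1_composite[OF assms]] show ?thesis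
    by (simp only: compose_paths_def)
qed

lemma compose_paths_eqI:
  assumes "\<mu> \<in> paths T A f" "\<nu> \<in> paths T A f" "source_of T \<mu> = range_of T \<nu>"
    and "is_composite T A f \<mu> \<nu> \<kappa>"
  shows "compose_paths T A f \<mu> \<nu> = \<kappa>"
proof -
  from the1_equality[OF ex1_composite[OF assms(1-3)] assms(4)] show ?thesis
    by (simp only: compose_paths_def)
qed

lemma is_compositeD:
  assumes "is_composite T A f \<mu> \<nu> \<kappa>"
  shows "\<kappa> \<in> paths T A f" "path_degree \<kappa> = path_degree \<mu> + path_degree \<nu>"
    "segment T \<kappa> 0 (path_degree \<mu>) = \<mu>"
    "segment T \<kappa> (path_degree \<mu>) (path_degree \<kappa>) = \<nu>"
proof -
  have \<kappa>: "\<kappa> \<in> paths_of_degree T A f (path_degree \<mu> + path_degree \<nu>)"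
    and first: "segment T \<kappa> 0 (path_degree \<mu>) = \<mu>"
    and rest: "segment T \<kappa> (path_degree \<mu>) (path_degree \<mu> + path_degree \<nu>) = \<nu>"
    using assms by (simp_all only: is_composite_def)
  show "\<kappa> \<in> paths T A f" using \<kappa> unfolding paths_def by blast
  show deg: "path_degree \<kappa> = path_degree \<mu> + path_degree \<nu>"
    using \<kappa> unfolding mem_paths_of_degree_iff path_degree_def by blast
  show "segment T \<kappa> 0 (path_degree \<mu>) = \<mu>" by (rule first)
  show "segment T \<kappa> (path_degree \<mu>) (path_degree \<kappa>) = \<nu>" using rest by (simp only: deg)
qed

lemma is_compositeI:
  assumes "\<kappa> \<in> paths T A f" "m \<le> path_degree \<kappa>"
  shows "is_composite T A f (segment T \<kappa> 0 m) (segment T \<kappa> m (path_degree \<kappa>)) \<kappa>"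
proof -
  have "m + (path_degree \<kappa> - m) = path_degree \<kappa>" using assms(2) by (auto simp: N2_simps)
  then show ?thesis
    using assms(1)
    by (simp add: is_composite_def segment_degree mem_paths_of_degree_iff mem_paths_iff)
      (simp add: path_degree_def)
qed

lemma le_add_N2: "(m::N2) \<le> m + n" "(n::N2) \<le> m + n" "(0::N2) \<le> m"
  by (auto simp: N2_simps)

lemma composite_range_source:
  assumes "is_composite T A f \<mu> \<nu> \<kappa>"
  shows "range_of T \<kappa> = range_of T \<mu>" "source_of T \<kappa> = source_of T \<nu>"
proof -
  note D = is_compositeD[OF assms]
  have le: "path_degree \<mu> \<le> path_degree \<kappa>" using D(2) by (simp add: le_add_N2)
  show "range_of T \<kappa> = range_of T \<mu>"
    using segment_in_paths(2)[OF D(1) le_add_N2(3) le] D(3) by (simp add: range_of_def)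
  show "source_of T \<kappa> = source_of T \<nu>"
    using segment_in_paths(3)[OF D(1) le order_refl] D(4) by (simp add: source_of_def)
qed

text \<open>The left-hand side \<open>\<tau>\<close> restricts to \<open>\<kappa>\<close>, \<open>\<mu>\<close> and \<open>\<nu>\<close> on three consecutive segments. Its final
  segment \<open>\<rho>\<close> of degree \<open>d \<mu> + d \<nu>\<close> therefore is a composite of \<open>\<mu>\<close> and \<open>\<nu>\<close>, so that \<open>\<tau>\<close> is also a
  composite of \<open>\<kappa>\<close> and \<open>\<mu>\<nu>\<close>; uniqueness of composites does the rest.\<close>

lemma compose_paths_assoc:
  assumes \<kappa>: "\<kappa> \<in> paths T A f" and \<mu>: "\<mu> \<in> paths T A f" and \<nu>: "\<nu> \<in> paths T A f"
    and \<kappa>\<mu>: "source_of T \<kappa> = range_of T \<mu>" and \<mu>\<nu>: "source_of T \<mu> = range_of T \<nu>"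
  shows "compose_paths T A f (compose_paths T A f \<kappa> \<mu>) \<nu> =
    compose_paths T A f \<kappa> (compose_paths T A f \<mu> \<nu>)"
proof -
  note c1 = is_composite_compose_paths[OF \<kappa> \<mu> \<kappa>\<mu>]
  note c2 = is_composite_compose_paths[OF \<mu> \<nu> \<mu>\<nu>]
  note D1 = is_compositeD[OF c1] and D2 = is_compositeD[OF c2]
  have "source_of T (compose_paths T A f \<kappa> \<mu>) = range_of T \<nu>"
    using composite_range_source(2)[OF c1] \<mu>\<nu> by simp
  note c3 = is_composite_compose_paths[OF D1(1) \<nu> this]
  note D3 = is_compositeD[OF c3]
  define \<tau> where "\<tau> = compose_paths T A f (compose_paths T A f \<kappa> \<mu>) \<nu>"
  let ?k = "path_degree \<kappa>" and ?m = "path_degree \<mu>" and ?n = "path_degree \<nu>"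
  note D3 = D3[folded \<tau>_def]
  have deg: "path_degree \<tau> = ?k + ?m + ?n" using D3(2) D1(2) by simp
  have head: "segment T \<tau> 0 (?k + ?m) = compose_paths T A f \<kappa> \<mu>" using D3(3) D1(2) by simp
  have "segment T \<tau> 0 ?k = segment T (compose_paths T A f \<kappa> \<mu>) 0 ?k"
    unfolding head[symmetric] by (subst segment_segment) (auto simp: N2_simps)
  then have first: "segment T \<tau> 0 ?k = \<kappa>" using D1(3) by simp
  have "segment T \<tau> ?k (?k + ?m) = segment T (compose_paths T A f \<kappa> \<mu>) ?k (?k + ?m)"
    unfolding head[symmetric] by (subst segment_segment) (auto simp: N2_simps)
  then have second: "segment T \<tau> ?k (?k + ?m) = \<mu>" using D1(2,4) by simp
  have third: "segment T \<tau> (?k + ?m) (?k + ?m + ?n) = \<nu>" using D3(4) D1(2) deg by simp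
  define \<rho> where "\<rho> = segment T \<tau> ?k (path_degree \<tau>)"
  have le: "?k \<le> path_degree \<tau>" unfolding deg by (auto simp: N2_simps)
  have \<rho>_path: "\<rho> \<in> paths T A f"
    unfolding \<rho>_def by (rule segment_in_paths(1)[OF D3(1) le order_refl])
  have \<rho>_deg: "path_degree \<rho> = ?m + ?n"
    unfolding \<rho>_def segment_degree deg by (auto simp: N2_simps)
  have "segment T \<rho> 0 ?m = segment T \<tau> ?k (?k + ?m)"
    unfolding \<rho>_def by (subst segment_segment) (auto simp: deg N2_simps)
  moreover have "segment T \<rho> ?m (?m + ?n) = segment T \<tau> (?k + ?m) (?k + ?m + ?n)"
    unfolding \<rho>_def by (subst segment_segment) (auto simp: deg N2_simps add.assoc)
  ultimately have "is_composite T A f \<mu> \<nu> \<rho>"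
    using is_compositeI[OF \<rho>_path, of ?m] second third by (simp add: \<rho>_deg le_add_N2)
  then have "compose_paths T A f \<mu> \<nu> = \<rho>" by (rule compose_paths_eqI[OF \<mu> \<nu> \<mu>\<nu>])
  moreover have "is_composite T A f \<kappa> \<rho> \<tau>"
    using is_compositeI[OF D3(1) le] first by (simp add: \<rho>_def)
  moreover have "source_of T \<kappa> = range_of T (compose_paths T A f \<mu> \<nu>)"
    using \<kappa>\<mu> composite_range_source(1)[OF c2] by simp
  ultimately show ?thesis
    using compose_paths_eqI[OF \<kappa> D2(1)] unfolding \<tau>_def by simp
qed

lemma source_degree_zero: "source_of T (0, v) = range_of T (0, v)"
  by (simp add: source_of_def range_of_def path_degree_def)

lemma vertex_path:
  assumes "v \<in> vertices T A f"
  shows "(0, v) \<in> paths T A f" "range_of T (0, v) = v"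
proof -
  have v: "v \<in> T \<rightarrow>\<^sub>E A" using assms vertices_iff by blast
  then have pb: "pull_back T v 0 = v"
    by (auto simp: pull_back_def intro: extensional_restrict)
  then show "range_of T (0, v) = v" by (simp add: range_of_def)
  have "{..0::N2} = {0}" by (auto simp: N2_simps)
  then show "(0, v) \<in> paths T A f"
    using pb v assms region_zero[of T] by (simp add: mem_paths_iff configurations_def)
qed

lemma segment_trivial: "segment T \<kappa> m m = (0, pull_back T (snd \<kappa>) m)"
  by (simp add: segment_pull_back region_zero)

text \<open>Every path is the composite of its own segments, and the initial and final segments of degree
  0 are its range and its source.\<close>

lemma is_identity_vertex:
  assumes v: "v \<in> vertices T A f"
  shows "is_identity (paths T A f) (range_of T) (source_of T) (compose_paths T A f) v (0, v)"
proof -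
  note p = vertex_path[OF v]
  have s: "source_of T (0, v) = v" using p(2) by (simp add: source_degree_zero)
  have "compose_paths T A f (0, v) \<mu> = \<mu>" if \<mu>: "\<mu> \<in> paths T A f" "range_of T \<mu> = v" for \<mu>
  proof (rule compose_paths_eqI[OF p(1) \<mu>(1)])
    show "is_composite T A f (0, v) \<mu> \<mu>"
      using is_compositeI[OF \<mu>(1) le_add_N2(3)] \<mu>
      by (simp add: segment_trivial segment_whole range_of_def)
  qed (use s \<mu> in simp)
  moreover have "compose_paths T A f \<mu> (0, v) = \<mu>" if \<mu>: "\<mu> \<in> paths T A f" "source_of T \<mu> = v" for \<mu>
  proof (rule compose_paths_eqI[OF \<mu>(1) p(1)])
    show "is_composite T A f \<mu> (0, v) \<mu>"
      using is_compositeI[OF \<mu>(1) order_refl] \<mu>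
      by (simp add: segment_trivial segment_whole source_of_def)
  qed (use p \<mu> in simp)
  ultimately show ?thesis using p s by (simp add: is_identity_def)
qed

lemma path_ends_in_vertices:
  assumes "\<mu> \<in> paths T A f"
  shows "range_of T \<mu> \<in> vertices T A f" "source_of T \<mu> \<in> vertices T A f"
  using assms le_add_N2(3)
  by (auto simp: range_of_def source_of_def path_degree_def mem_paths_iff configurations_def)

lemma paths_form_category:
  "small_category (vertices T A f) (paths T A f) (range_of T) (source_of T)
    (compose_paths T A f)"
proof
  fix v assume "v \<in> vertices T A f"
  then show "\<exists>e. is_identity (paths T A f) (range_of T) (source_of T) (compose_paths T A f) v e"
    using is_identity_vertex by blast
qed (auto simp: path_ends_in_vertices compose_paths_assoc is_compositeD(1)[OF is_composite_compose_paths]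
      composite_range_source[OF is_composite_compose_paths])

lemma path_degree_functor:
  "degree_functor (vertices T A f) (paths T A f) (range_of T) (source_of T)
    (compose_paths T A f) path_degree"
  unfolding degree_functor_def
proof (intro conjI ballI allI impI)
  fix v e assume v: "v \<in> vertices T A f"
    and e: "is_identity (paths T A f) (range_of T) (source_of T) (compose_paths T A f) v e"
  \<comment> \<open>identities are unique, so \<open>e\<close> is the path of degree 0 given by \<open>v\<close>\<close>
  note i = is_identity_vertex[OF v, unfolded is_identity_def] and e = e[unfolded is_identity_def]
  have "e = compose_paths T A f e (0, v)" using i e by metis
  also have "\<dots> = (0, v)" using i e by blast
  finally show "path_degree e = 0" by (simp add: path_degree_def)
next
  fix \<mu> \<nu> assume "\<mu> \<in> paths T A f" "\<nu> \<in> paths T A f" "source_of T \<mu> = range_of T \<nu>"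
  then show "path_degree (compose_paths T A f \<mu> \<nu>) = path_degree \<mu> + path_degree \<nu>"
    by (rule is_compositeD(2)[OF is_composite_compose_paths])
qed

text \<open>A factorisation of \<open>\<kappa>\<close> with degrees \<open>m\<close> and \<open>n\<close> has to consist of the two segments of \<open>\<kappa>\<close> that
  meet at \<open>m\<close>, and these do compose to \<open>\<kappa>\<close>.\<close>

lemma path_degree_factorisation:
  "factorisation_property (paths T A f) (range_of T) (source_of T)
    (compose_paths T A f) path_degree"
  unfolding factorisation_property_def
proof (intro ballI allI impI)
  fix \<kappa> m n assume \<kappa>: "\<kappa> \<in> paths T A f" and deg: "path_degree \<kappa> = m + n"
  have le: "m \<le> path_degree \<kappa>" using deg by (simp add: le_add_N2)
  let ?\<mu> = "segment T \<kappa> 0 m" and ?\<nu> = "segment T \<kappa> m (path_degree \<kappa>)"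
  note \<mu> = segment_in_paths[OF \<kappa> le_add_N2(3) le] and \<nu> = segment_in_paths[OF \<kappa> le order_refl]
  have match: "source_of T ?\<mu> = range_of T ?\<nu>" using \<mu>(3) \<nu>(2) by simp
  let ?P = "\<lambda>\<mu> \<nu>. \<mu> \<in> paths T A f \<and> \<nu> \<in> paths T A f \<and> source_of T \<mu> = range_of T \<nu> \<and>
      path_degree \<mu> = m \<and> path_degree \<nu> = n \<and> \<kappa> = compose_paths T A f \<mu> \<nu>"
  have "\<kappa> = compose_paths T A f ?\<mu> ?\<nu>"
    by (rule compose_paths_eqI[OF \<mu>(1) \<nu>(1) match is_compositeI[OF \<kappa> le], symmetric])
  moreover have "path_degree ?\<mu> = m" "path_degree ?\<nu> = n"
    by (auto simp: segment_degree deg N2_simps)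
  ultimately have "?P ?\<mu> ?\<nu>"
    using \<mu>(1) \<nu>(1) match by (intro conjI)
  then have "?P (fst (?\<mu>, ?\<nu>)) (snd (?\<mu>, ?\<nu>))" by (simp only: fst_conv snd_conv)
  moreover have "z = (?\<mu>, ?\<nu>)" if P: "?P (fst z) (snd z)" for z
  proof -
    obtain \<mu> \<nu> where z: "z = (\<mu>, \<nu>)" by (rule prod.exhaust)
    have paths: "\<mu> \<in> paths T A f" "\<nu> \<in> paths T A f" "source_of T \<mu> = range_of T \<nu>"
      and m: "path_degree \<mu> = m" and comp: "\<kappa> = compose_paths T A f \<mu> \<nu>"
      using P unfolding z fst_conv snd_conv by blast+
    note D = is_compositeD[OF is_composite_compose_paths[OF paths], folded comp, unfolded m]
    show ?thesis unfolding z D(3) D(4) by (rule refl)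
  qed
  ultimately have "\<exists>!z. ?P (fst z) (snd z)" by (rule ex1I)
  then show "\<exists>!(\<mu>, \<nu>). ?P \<mu> \<nu>" by (simp only: case_prod_unfold)
qed

lemma countable_paths: "countable (paths T A f)"
proof -
  have "finite (region T {..n})" for n
    using finite_T finite_atMost_N2[of n] by (auto simp: region_def translate_def)
  then have "finite (region T {..n} \<rightarrow>\<^sub>E A)" for n
    using finite_alphabet by (intro finite_PiE) auto
  then have "countable ({n} \<times> (region T {..n} \<rightarrow>\<^sub>E A))" for n
    by (simp add: countable_finite)
  moreover have "paths_of_degree T A f n \<subseteq> {n} \<times> (region T {..n} \<rightarrow>\<^sub>E A)" for n
    by (auto simp: mem_paths_of_degree_iff configurations_def)
  ultimately have "countable (paths_of_degree T A f n)" for n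
    using countable_subset by metis
  then show ?thesis unfolding paths_def by (rule countable_UN[OF countableI_type])
qed

lemma countable_vertices: "countable (vertices T A f)"
proof -
  have "vertices T A f \<subseteq> range_of T ` paths T A f"
    using vertex_path by (metis image_eqI subsetI)
  then show ?thesis using countable_paths countable_subset by blast
qed

end

theorem theorem3p7:
  fixes T :: "N2 set" and A :: "'a set" and f :: "(N2 \<Rightarrow> 'a) \<Rightarrow> 'a \<Rightarrow> 'a"
  assumes "basic_data T A f"
  shows "(\<forall>\<mu>\<in>paths T A f. \<forall>\<nu>\<in>paths T A f. source_of T \<mu> = range_of T \<nu> \<longrightarrow>
            (\<exists>!\<kappa>. is_composite T A f \<mu> \<nu> \<kappa>)) \<and>
         small_category (vertices T A f) (paths T A f) (range_of T) (source_of T)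
           (compose_paths T A f) \<and>
         degree_functor (vertices T A f) (paths T A f) (range_of T) (source_of T)
           (compose_paths T A f) path_degree \<and>
         factorisation_property (paths T A f) (range_of T) (source_of T)
           (compose_paths T A f) path_degree \<and>
         two_graph (vertices T A f) (paths T A f) (range_of T) (source_of T)
           (compose_paths T A f) path_degree"
proof -
  interpret basic_data T A f by fact
  have "two_graph (vertices T A f) (paths T A f) (range_of T) (source_of T)
      (compose_paths T A f) path_degree"
    unfolding two_graph_def two_graph_axioms_def
    by (intro conjI paths_form_category countable_vertices countable_paths path_degree_functor
        path_degree_factorisation)
  then show ?thesis
    by (intro conjI ballI impI ex1_composite paths_form_category path_degree_functor
        path_degree_factorisation)
qed

end
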